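(* Let $P\in\mathbb{Z}[x]$ be a monic polynomial such that $\Delta(P_n)\neq0$ for all integers $n\ge1$. Then the integers $\delta_n(P)$, $n\ge1$, all have the same sign.
   Context: If $P$ has degree $d$ and roots $\alpha_1,\dots,\alpha_d$ (with multiplicity), then $P_n(x):=\prod_{j=1}^d(x-\alpha_j^n)\in\mathbb{Z}[x]$ and $\Delta(P_n)=\prod_{1\le j<k\le d}(\alpha_j^n-\alpha_k^n)^2$ is its discriminant. Define $\delta_n(P):=\sum_{m\mid n}\mu(n/m)\Delta(P_m)$, where $\mu$ is the Möbius function. *)

theory Defs
  imports
    "HOL-Computational_Algebra.Computational_Algebra"
    Complex_Main
begin

definition moebius_mu :: "nat \<Rightarrow> int" where
  "moebius_mu n = (if squarefree n then (-1) ^ card (prime_factors n) else 0)"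

definition prod_sq_diffs :: "complex list \<Rightarrow> complex" where
  "prod_sq_diffs xs = (\<Prod>k<length xs. \<Prod>j<k. (xs ! j - xs ! k)\<^sup>2)"

(* The discriminant of a monic complex polynomial. The chosen ordering of the roots
   (which are listed with multiplicity) is irrelevant, see discriminant_eq. No power of the
   leading coefficient is included, so this is the usual notion for monic polynomials only. *)
definition discriminant :: "complex poly \<Rightarrow> complex" where
  "discriminant Q = prod_sq_diffs (SOME xs. mset xs = proots Q)"

(* P_n, formed over the complex numbers. *)
definition power_poly :: "int poly \<Rightarrow> nat \<Rightarrow> complex poly" where
  "power_poly P n = (\<Prod>\<alpha>\<in>#proots (map_poly of_int P). [:- (\<alpha> ^ n), 1:])"

definition delta :: "int poly \<Rightarrow> nat \<Rightarrow> complex" where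
  "delta P n = (\<Sum>m | m dvd n. of_int (moebius_mu (n div m)) * discriminant (power_poly P m))"

lemma prod_sq_diffs_Nil [simp]: "prod_sq_diffs [] = 1"
  by (simp add: prod_sq_diffs_def)

lemma prod_sq_diffs_Cons [simp]:
  "prod_sq_diffs (x # xs) = (\<Prod>y\<leftarrow>xs. (x - y)\<^sup>2) * prod_sq_diffs xs"
proof -
  have "(\<Prod>y\<leftarrow>xs. (x - y)\<^sup>2) = (\<Prod>k<length xs. (x - xs ! k)\<^sup>2)"
    by (simp add: prod.list_conv_set_nth atLeast0LessThan)
  thus ?thesis
    unfolding prod_sq_diffs_def
    by (simp add: prod.lessThan_Suc_shift prod.distrib del: prod.lessThan_Suc)
qed

lemma prod_sq_diffs_move:
  "prod_sq_diffs (us @ x # vs) = prod_sq_diffs (x # us @ vs)"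
  by (induction us) (simp_all add: power2_commute[of _ x] mult_ac)

lemma prod_sq_diffs_perm:
  "mset xs = mset ys \<Longrightarrow> prod_sq_diffs xs = prod_sq_diffs ys"
proof (induction xs arbitrary: ys)
  case (Cons x xs)
  from Cons.prems have "x \<in> set ys"
    using mset_eq_setD[OF Cons.prems] by auto
  then obtain us vs where ys: "ys = us @ x # vs"
    by (meson split_list)
  from Cons.prems ys have m: "mset xs = mset (us @ vs)"
    by simp
  have "(\<Prod>y\<leftarrow>xs. (x - y)\<^sup>2) = (\<Prod>y\<leftarrow>us @ vs. (x - y)\<^sup>2)"
    unfolding prod_mset_prod_list[symmetric] mset_map m by simp
  with Cons.IH[OF m] show ?case
    unfolding ys prod_sq_diffs_move by simp
qed simp

lemma discriminant_eq:
  assumes "mset xs = proots Q"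
  shows   "discriminant Q = prod_sq_diffs xs"
  unfolding discriminant_def
  using someI[of "\<lambda>xs. mset xs = proots Q", OF assms] assms
  by (intro prod_sq_diffs_perm) simp

lemma proots_power_poly:
  "proots (power_poly P n) = image_mset (\<lambda>\<alpha>. \<alpha> ^ n) (proots (map_poly of_int P))"
proof -
  have "proots (\<Prod>\<alpha>\<in>#A. [:- (\<alpha> ^ n), 1:]) = image_mset (\<lambda>\<alpha>. \<alpha> ^ n) A" for A :: "complex multiset"
  proof (induction A)
    case (add a A)
    have "(\<Prod>\<alpha>\<in>#A. [:- (\<alpha> ^ n), 1:]) \<noteq> 0"
      by (auto simp: prod_mset_zero_iff)
    with add show ?case
      by (simp add: proots_mult del: mult_pCons_left)
  qed simp
  thus ?thesis
    by (simp add: power_poly_def)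
qed

lemma discriminant_power_poly:
  assumes "mset \<alpha>s = proots (map_poly of_int P)"
  shows   "discriminant (power_poly P n) =
             (\<Prod>k<length \<alpha>s. \<Prod>j<k. (\<alpha>s ! j ^ n - \<alpha>s ! k ^ n)\<^sup>2)"
proof -
  have "mset (map (\<lambda>\<alpha>. \<alpha> ^ n) \<alpha>s) = proots (power_poly P n)"
    by (simp add: proots_power_poly assms)
  hence "discriminant (power_poly P n) = prod_sq_diffs (map (\<lambda>\<alpha>. \<alpha> ^ n) \<alpha>s)"
    by (rule discriminant_eq)
  also have "\<dots> = (\<Prod>k<length \<alpha>s. \<Prod>j<k. (\<alpha>s ! j ^ n - \<alpha>s ! k ^ n)\<^sup>2)"
    unfolding prod_sq_diffs_def by (intro prod.cong) simp_all
  finally show ?thesis .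
qed

end

theory Submission
  imports Defs "Jordan_Normal_Form.Char_Poly"
begin

text \<open>
  Write \<open>x\<^sup>n - y\<^sup>n\<close> as the product of the homogeneous cyclotomic forms
  \<open>\<phi>\<^sub>e(x, y)\<close> with \<open>e dvd n\<close>. Up to a sign independent of \<open>n\<close>, the discriminant of \<open>P\<^sub>n\<close> is
  therefore the product over \<open>e dvd n\<close> of \<open>N\<^sub>e = \<Prod>\<^bsub>j \<noteq> k\<^esub> \<phi>\<^sub>e(\<alpha>\<^sub>j, \<alpha>\<^sub>k)\<close>, and each \<open>N\<^sub>e\<close> is a
  nonzero integer, so \<open>\<bar>N\<^sub>e\<bar> = 1 + g\<^sub>e\<close> with \<open>g\<^sub>e \<ge> 0\<close>. The Moebius transform of
  \<open>n \<mapsto> \<Prod>\<^bsub>e dvd n\<^esub> (1 + g\<^sub>e)\<close> is a sum of products of the \<open>g\<^sub>e\<close>, hence nonnegative. Finally the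
  discriminant of \<open>P\<^sub>n\<close> is that of \<open>P\<close> times the square of a real number, so its sign does not
  depend on \<open>n\<close>.
\<close>

section \<open>Norms modulo a monic polynomial\<close>

text \<open>A nonzero kernel vector would give a nonzero polynomial of degree below
  \<open>length bs\<close> vanishing on all of \<open>bs\<close>.\<close>

lemma det_vandermonde_nonzero:
  fixes bs :: "'a :: field list"
  assumes "distinct bs"
  shows "det (mat (length bs) (length bs) (\<lambda>(i, j). bs ! i ^ j)) \<noteq> 0"
proof
  let ?d = "length bs"
  let ?V = "mat ?d ?d (\<lambda>(i, j). bs ! i ^ j)"
  assume "det ?V = 0"
  then obtain v where v: "v \<in> carrier_vec ?d" "v \<noteq> 0\<^sub>v ?d" "?V *\<^sub>v v = 0\<^sub>v ?d"
    using det_0_iff_vec_prod_zero[of ?V ?d] by auto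
  define p where "p = (\<Sum>j<?d. monom (v $ j) j)"
  have coeff_p: "coeff p j = (if j < ?d then v $ j else 0)" for j
    by (simp add: p_def coeff_sum)
  have root: "poly p b = 0" if b: "b \<in> set bs" for b
  proof -
    from b obtain i where i: "i < ?d" "b = bs ! i"
      by (auto simp: in_set_conv_nth)
    have "poly p b = (?V *\<^sub>v v) $ i"
      using i v(1)
      by (auto simp: p_def poly_sum poly_monom scalar_prod_def atLeast0LessThan mult.commute
               intro!: sum.cong)
    with i v(3) show ?thesis by simp
  qed
  have "p = 0"
  proof (rule ccontr)
    assume p: "p \<noteq> 0"
    have "degree p < ?d"
      using p coeff_p[of "degree p"] by (auto split: if_splits)
    moreover have "card (set bs) \<le> card {x. poly p x = 0}"
      using p root by (intro card_mono poly_roots_finite) auto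
    moreover have "card {x. poly p x = 0} \<le> degree p"
      using p by (rule card_poly_roots_bound)
    ultimately show False
      using assms by (simp add: distinct_card)
  qed
  hence "v = 0\<^sub>v ?d"
    using v(1) coeff_p by (intro eq_vecI) (auto split: if_splits, metis coeff_0)
  with v(2) show False by contradiction
qed

text \<open>Fixes the number of terms at a matrix dimension \<open>d\<close>, whatever the degrees
  of \<open>p\<close> and of its image under \<open>h\<close>.\<close>

lemma poly_map_poly_eq_sum:
  assumes "h 0 = (0 :: 'b :: comm_semiring_1)" "\<And>i. i \<ge> d \<Longrightarrow> coeff p i = 0"
  shows "poly (map_poly h p) x = (\<Sum>i<d. h (coeff p i) * x ^ i)"
proof -
  have "poly (map_poly h p) x = (\<Sum>i\<le>degree (map_poly h p). h (coeff p i) * x ^ i)"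
    using assms(1) by (simp add: poly_altdef coeff_map_poly)
  also have "\<dots> = (\<Sum>i\<le>max d (degree (map_poly h p)). h (coeff p i) * x ^ i)"
    using assms(1)
    by (intro sum.mono_neutral_left) (auto simp: coeff_map_poly intro!: le_degree)
  also have "\<dots> = (\<Sum>i<d. h (coeff p i) * x ^ i)"
    using assms by (intro sum.mono_neutral_right) auto
  finally show ?thesis .
qed

text \<open>The element \<open>r\<close> is the norm of \<open>f\<close> from \<open>R[X]/(Q)\<close> to the coefficient ring \<open>R\<close>. It has to be
  chosen before the homomorphism \<open>h\<close>: below, \<open>h\<close> evaluates integer polynomials at a root of \<open>P\<close>,
  and the same \<open>r\<close> must serve all roots. The Vandermonde matrix of \<open>A\<close> diagonalizes the
  multiplication by \<open>f\<close>.\<close>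
lemma monic_norm_exists:
  fixes Q f :: "'a :: idom poly"
  assumes monic: "lead_coeff Q = 1"
  obtains r where
    "\<And>(h :: 'a \<Rightarrow> 'b :: field) A. comm_ring_hom h \<Longrightarrow> finite A \<Longrightarrow> card A = degree Q \<Longrightarrow>
       (\<And>a. a \<in> A \<Longrightarrow> poly (map_poly h Q) a = 0) \<Longrightarrow>
       (\<Prod>a\<in>A. poly (map_poly h f) a) = h r"
proof -
  define d where "d = degree Q"
  define qr where "qr j = pseudo_divmod (f * monom 1 j) Q" for j
  define R where "R j = snd (qr j)" for j
  \<comment> \<open>As \<open>Q\<close> is monic, pseudo-division is honest division. Column
    \<open>j\<close> holds the coordinates of f X^j modulo Q, so \<open>M\<close> is the matrix of
    multiplication by \<open>f\<close> and its determinant is the norm.\<close>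
  define M where "M = mat d d (\<lambda>(i, j). coeff (R j) i)"
  have [simp]: "Q \<noteq> 0" using monic by auto
  have div: "f * monom 1 j = Q * fst (qr j) + R j"
    and deg: "R j = 0 \<or> degree (R j) < d" for j
    using pseudo_divmod[of Q "f * monom 1 j" "fst (qr j)" "R j"] monic
    by (simp_all add: qr_def R_def d_def)
  have coeff_R: "coeff (R j) i = 0" if "i \<ge> d" for i j
    using deg[of j] that by (auto intro: coeff_eq_0)
  show ?thesis
  proof (rule that)
    fix h :: "'a \<Rightarrow> 'b" and A
    assume h: "comm_ring_hom h" and A: "finite A" "card A = degree Q"
      and root: "\<And>a. a \<in> A \<Longrightarrow> poly (map_poly h Q) a = 0"
    interpret comm_ring_hom h by fact
    interpret mp: map_poly_comm_ring_hom h ..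
    obtain bs where bs: "set bs = A" "distinct bs"
      using A(1) finite_distinct_list by blast
    have len: "length bs = d"
      using bs A by (metis distinct_card d_def)
    define V where "V = mat d d (\<lambda>(i, j). bs ! i ^ j)"
    define D where "D = mat d d (\<lambda>(i, j). if i = j then poly (map_poly h f) (bs ! i) else 0)"
    have carrier: "V \<in> carrier_mat d d" "D \<in> carrier_mat d d" "map_mat h M \<in> carrier_mat d d"
      by (simp_all add: V_def D_def M_def)
    \<comment> \<open>Row \<open>i\<close> of \<open>V\<close> evaluates at the root
      \<open>bs ! i\<close>, where the images of \<open>R j\<close> and of f X^j agree.\<close>
    have "V * map_mat h M = D * V"
    proof (rule eq_matI)
      fix i j assume "i < dim_row (D * V)" "j < dim_col (D * V)"
      hence ij: "i < d" "j < d" by (simp_all add: D_def V_def)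
      have b: "bs ! i \<in> A" using ij len bs by auto
      have "(V * map_mat h M) $$ (i, j) = (\<Sum>k<d. h (coeff (R j) k) * (bs ! i) ^ k)"
        using ij by (simp add: V_def M_def scalar_prod_def atLeast0LessThan mult.commute)
      also have "\<dots> = poly (map_poly h (R j)) (bs ! i)"
        using coeff_R by (subst poly_map_poly_eq_sum[of h d]) auto
      also have "\<dots> = poly (map_poly h (f * monom 1 j)) (bs ! i)"
        unfolding div using root[OF b] by (simp add: hom_distribs)
      also have "\<dots> = poly (map_poly h f) (bs ! i) * (bs ! i) ^ j"
        by (simp add: hom_distribs poly_monom)
      also have "\<dots> = (\<Sum>k<d. (if i = k then poly (map_poly h f) (bs ! i) else 0) * (bs ! k) ^ j)"
        using ij by (subst sum.remove[of _ i]) auto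
      also have "\<dots> = (D * V) $$ (i, j)"
        using ij by (simp add: V_def D_def scalar_prod_def atLeast0LessThan)
      finally show "(V * map_mat h M) $$ (i, j) = (D * V) $$ (i, j)" .
    qed (simp_all add: V_def D_def M_def)
    hence "det (V * map_mat h M) = det (D * V)" by (rule arg_cong)
    hence "det V * h (det M) = det D * det V"
      by (simp add: det_mult[OF carrier(1,3)] det_mult[OF carrier(2,1)])
    moreover have "det V \<noteq> 0"
      using det_vandermonde_nonzero[OF bs(2)] len by (simp add: V_def)
    ultimately have "h (det M) = det D" by simp
    also have "\<dots> = prod_list (diag_mat D)"
      by (rule det_upper_triangular) (auto simp: D_def)
    also have "\<dots> = (\<Prod>i<d. poly (map_poly h f) (bs ! i))"
      by (simp add: diag_mat_def D_def prod.list_conv_set_nth atLeast0LessThan)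
    also have "\<dots> = (\<Prod>b\<leftarrow>bs. poly (map_poly h f) b)"
      by (simp add: prod.list_conv_set_nth atLeast0LessThan len)
    also have "\<dots> = (\<Prod>a\<in>A. poly (map_poly h f) a)"
      unfolding bs(1)[symmetric] by (rule prod.distinct_set_conv_list[OF bs(2), symmetric])
    finally show "(\<Prod>a\<in>A. poly (map_poly h f) a) = h (det M)" ..
  qed
qed

section \<open>Integrality of products over pairs of roots\<close>

definition int_eval :: "complex \<Rightarrow> int poly \<Rightarrow> complex" where
  "int_eval x p = poly (map_poly of_int p) x"

text \<open>Here \<open>x\<close> replaces the coefficient variable X and \<open>y\<close> the outer
  variable Y of Z[X][Y]. The nesting allows a norm in Y over Z[X], followed by a norm in X over
  Z.\<close>

definition int_eval2 :: "complex \<Rightarrow> complex \<Rightarrow> int poly poly \<Rightarrow> complex" where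
  "int_eval2 x y f = poly (map_poly (int_eval x) f) y"

lemma comm_ring_hom_int_eval: "comm_ring_hom (int_eval x)"
  by unfold_locales (simp_all add: int_eval_def hom_distribs)

lemma comm_ring_hom_int_eval2: "comm_ring_hom (int_eval2 x y)"
proof -
  interpret comm_ring_hom "int_eval x" by (rule comm_ring_hom_int_eval)
  interpret mp: map_poly_comm_ring_hom "int_eval x" ..
  show ?thesis
    by unfold_locales (simp_all add: int_eval2_def hom_distribs)
qed

lemma int_eval2_pCons: "int_eval2 x y (pCons c f) = int_eval x c + y * int_eval2 x y f"
proof -
  interpret comm_ring_hom "int_eval x" by (rule comm_ring_hom_int_eval)
  show ?thesis by (simp add: int_eval2_def hom_distribs)
qed

lemma int_eval2_monom: "int_eval2 x y (monom c n) = int_eval x c * y ^ n"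
proof -
  interpret comm_ring_hom "int_eval x" by (rule comm_ring_hom_int_eval)
  show ?thesis by (simp add: int_eval2_def map_poly_monom poly_monom)
qed

lemma int_eval_monom: "int_eval x (monom c n) = of_int c * x ^ n"
  by (simp add: int_eval_def map_poly_monom poly_monom)

lemma int_eval_const: "int_eval x [:c:] = of_int c"
  using int_eval_monom[of x c 0] by (simp add: monom_0)

text \<open>The polynomial \<open>Q\<close> is \<open>(P(Y) - P(X)) / (Y - X)\<close>, so for a root \<open>x\<close> of \<open>P\<close> its specialization
  at \<open>X = x\<close> vanishes at the remaining roots.\<close>
lemma divided_difference_exists:
  fixes P :: "int poly"
  assumes monic: "lead_coeff P = 1" and deg: "degree P > 0"
  obtains Q :: "int poly poly" where "lead_coeff Q = 1" "degree Q = degree P - 1"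
    "\<And>x y. int_eval x P = 0 \<Longrightarrow> int_eval y P = 0 \<Longrightarrow> x \<noteq> y \<Longrightarrow> int_eval2 x y Q = 0"
proof -
  define P' where "P' = map_poly (\<lambda>c :: int. [:c:]) P"
  \<comment> \<open>Despite its name this is the coefficient variable X. \<open>P'\<close> is P in
    the outer variable, so the remainder \<open>poly P' Y\<close> is P(X).\<close>
  define Y :: "int poly" where "Y = [:0, 1:]"
  define Q where "Q = synthetic_div P' Y"
  have eq: "[:-Y, 1:] * Q + [:poly P' Y:] = P'"
    unfolding Q_def by (rule synthetic_div_correct')
  have degP': "degree P' = degree P"
    unfolding P'_def by (rule degree_map_poly) auto
  have lcP': "coeff P' (degree P) = 1"
    using monic by (simp add: P'_def coeff_map_poly one_pCons)
  have degQ: "degree Q = degree P - 1"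
    by (simp add: Q_def degree_synthetic_div degP')
  have "coeff P' (degree P) = coeff Q (degree P - 1)"
  proof -
    obtain n where n: "degree P = Suc n" using deg by (cases "degree P") auto
    have "coeff Q (Suc n) = 0" using degQ n by (intro coeff_eq_0) simp
    hence "coeff ([:-Y, 1:] * Q + [:poly P' Y:]) (Suc n) = coeff Q n"
      by (simp add: coeff_pCons)
    thus ?thesis
      unfolding eq n by simp
  qed
  hence lcQ: "lead_coeff Q = 1"
    using lcP' degQ by simp
  have ev: "int_eval2 x y P' = int_eval y P" for x y
  proof -
    interpret comm_ring_hom "int_eval x" by (rule comm_ring_hom_int_eval)
    have "map_poly (int_eval x) P' = map_poly of_int P"
      by (rule poly_eqI) (simp add: P'_def coeff_map_poly int_eval_const)
    thus ?thesis by (simp add: int_eval2_def int_eval_def)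
  qed
  have main: "(y - x) * int_eval2 x y Q + int_eval x (poly P' Y) = int_eval y P" for x y
  proof -
    interpret comm_ring_hom "int_eval2 x y" by (rule comm_ring_hom_int_eval2)
    have "int_eval x Y = x" "int_eval x 1 = 1" "int_eval x (-Y) = -x" "int_eval2 x y 0 = 0"
      by (simp_all add: int_eval_def Y_def hom_distribs)
    hence "int_eval2 x y ([:-Y, 1:] * Q + [:poly P' Y:]) 
        = (y - x) * int_eval2 x y Q + int_eval x (poly P' Y)"
      by (simp only: hom_add hom_mult int_eval2_pCons) simp
    thus ?thesis using ev[of x y] eq by simp
  qed
  \<comment> \<open>Equal arguments in \<open>main\<close> show that the remainder vanishes at
    \<open>x\<close>; for distinct roots the factor \<open>y - x\<close> then cancels.\<close>
  have "int_eval2 x y Q = 0" if "int_eval x P = 0" "int_eval y P = 0" "x \<noteq> y" for x y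
    using main[of x x] main[of y x] that by simp
  with that lcQ degQ show ?thesis by blast
qed

text \<open>Two norms in succession: for a root \<open>x\<close>, the other roots number
  \<open>degree Q\<close> and annihilate the divided difference at \<open>x\<close>, so the inner
  product is r(x) for one \<open>r\<close> in Z[X]; the norm of \<open>r\<close> modulo
  \<open>P\<close> is an integer.\<close>

lemma prod_distinct_root_pairs_in_Ints:
  fixes P :: "int poly" and f :: "int poly poly"
  assumes monic: "lead_coeff P = 1" and A: "A = {x. int_eval x P = 0}" "card A = degree P"
  shows "(\<Prod>x\<in>A. \<Prod>y\<in>A - {x}. int_eval2 x y f) \<in> \<int>"
proof (cases "degree P = 0")
  case True
  hence "P = 1" using monic by (auto elim!: degree_eq_zeroE)
  hence "A = {}" by (simp add: A int_eval_def)
  thus ?thesis by simp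
next
  case False
  have fin: "finite A" using False A by (metis card.infinite)
  obtain Q where Q: "lead_coeff Q = 1" "degree Q = degree P - 1"
    "\<And>x y. int_eval x P = 0 \<Longrightarrow> int_eval y P = 0 \<Longrightarrow> x \<noteq> y \<Longrightarrow> int_eval2 x y Q = 0"
    using divided_difference_exists[OF monic] False by blast
  obtain r where r: "\<And>(h :: int poly \<Rightarrow> complex) A. comm_ring_hom h \<Longrightarrow> finite A \<Longrightarrow>
       card A = degree Q \<Longrightarrow> (\<And>a. a \<in> A \<Longrightarrow> poly (map_poly h Q) a = 0) \<Longrightarrow>
       (\<Prod>a\<in>A. poly (map_poly h f) a) = h r"
    using monic_norm_exists[OF Q(1)] by metis
  obtain s where s: "\<And>(h :: int \<Rightarrow> complex) A. comm_ring_hom h \<Longrightarrow> finite A \<Longrightarrow>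
       card A = degree P \<Longrightarrow> (\<And>a. a \<in> A \<Longrightarrow> poly (map_poly h P) a = 0) \<Longrightarrow>
       (\<Prod>a\<in>A. poly (map_poly h r) a) = h s"
    using monic_norm_exists[OF monic] by metis
  have "(\<Prod>y\<in>A - {x}. int_eval2 x y f) = int_eval x r" if "x \<in> A" for x
    using that A Q fin unfolding int_eval2_def
    by (intro r comm_ring_hom_int_eval) (auto simp: card_Diff_singleton)
  hence "(\<Prod>x\<in>A. \<Prod>y\<in>A - {x}. int_eval2 x y f) = (\<Prod>x\<in>A. int_eval x r)"
    by simp
  also have "\<dots> = of_int s"
    unfolding int_eval_def using A fin
    by (intro s) (auto simp: int_eval_def intro: of_int_hom.comm_ring_hom_axioms)
  finally show ?thesis by simp
qed

section \<open>Roots of unity and cyclotomic polynomials\<close>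

text \<open>For \<open>e = 0\<close> this is the whole complex plane, hence the positivity
  assumptions below.\<close>

definition primitive_roots_unity :: "nat \<Rightarrow> complex set" where
  "primitive_roots_unity e = {z. z ^ e = 1 \<and> (\<forall>k. 0 < k \<and> k < e \<longrightarrow> z ^ k \<noteq> 1)}"

lemma finite_roots_unity_pos: "n > 0 \<Longrightarrow> finite {z :: complex. z ^ n = 1}"
  by (rule finite_roots_unity) simp

lemma finite_primitive_roots_unity: "e > 0 \<Longrightarrow> finite (primitive_roots_unity e)"
  by (rule finite_subset[OF _ finite_roots_unity_pos[of e]]) (auto simp: primitive_roots_unity_def)

lemma disjoint_primitive_roots_unity:
  assumes "d > 0" "e > 0" "d \<noteq> e"
  shows "primitive_roots_unity d \<inter> primitive_roots_unity e = {}"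
  using assms by (auto simp: primitive_roots_unity_def) (metis linorder_neqE_nat)

lemma Union_primitive_roots_unity:
  assumes "n > 0"
  shows "(\<Union>e\<in>{e. e dvd n}. primitive_roots_unity e) = {z. z ^ n = 1}"
proof (intro equalityI subsetI)
  fix z assume "z \<in> (\<Union>e\<in>{e. e dvd n}. primitive_roots_unity e)"
  thus "z \<in> {z. z ^ n = 1}"
    by (auto simp: primitive_roots_unity_def power_mult elim!: dvdE)
next
  fix z :: complex assume "z \<in> {z. z ^ n = 1}"
  hence z: "z ^ n = 1" by simp
  define e where "e = (LEAST k. k > 0 \<and> z ^ k = 1)"
  have e: "e > 0 \<and> z ^ e = 1"
    unfolding e_def by (rule LeastI[of _ n]) (use z assms in auto)
  have least: "z ^ k \<noteq> 1" if "0 < k" "k < e" for k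
    using not_less_Least[of k "\<lambda>k. k > 0 \<and> z ^ k = 1"] that by (auto simp: e_def)
  \<comment> \<open>The remainder is an exponent below \<open>e\<close> that sends \<open>z\<close>
    to 1, so minimality of \<open>e\<close> makes it 0.\<close>
  have "z ^ (n mod e) = (z ^ e) ^ (n div e) * z ^ (n mod e)" using e by simp
  also have "\<dots> = z ^ n"
    by (simp flip: power_mult power_add)
  finally have "n mod e = 0"
    using least[of "n mod e"] e z by (metis mod_less_divisor gr0I)
  hence "e dvd n" by auto
  moreover have "z \<in> primitive_roots_unity e"
    using e least by (auto simp: primitive_roots_unity_def)
  ultimately show "z \<in> (\<Union>e\<in>{e. e dvd n}. primitive_roots_unity e)" by blast
qed

lemma prod_roots_unity_by_order:
  assumes "n > 0"
  shows "(\<Prod>z | z ^ n = 1. f z) = (\<Prod>e | e dvd n. \<Prod>z\<in>primitive_roots_unity e. f z)"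
  unfolding Union_primitive_roots_unity[OF assms, symmetric]
proof (rule prod.UNION_disjoint)
  show "finite {e. e dvd n}" using assms by simp
  show "\<forall>e\<in>{e. e dvd n}. finite (primitive_roots_unity e)"
    using assms by (auto intro!: finite_primitive_roots_unity intro: Nat.gr0I)
  show "\<forall>d\<in>{e. e dvd n}. \<forall>e\<in>{e. e dvd n}. d \<noteq> e \<longrightarrow>
          primitive_roots_unity d \<inter> primitive_roots_unity e = {}"
    using assms by (intro ballI impI disjoint_primitive_roots_unity) (auto intro: Nat.gr0I)
qed

lemma degree_prod_linear: "degree (\<Prod>z\<in>A. [:- z, 1 :: 'a :: idom:]) = card A"
  by (subst degree_prod_eq_sum_degree) auto

lemma lead_coeff_prod_linear: "lead_coeff (\<Prod>z\<in>A. [:- z, 1 :: 'a :: idom:]) = 1"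
  by (subst lead_coeff_prod) auto

text \<open>Both sides are monic of degree \<open>n\<close> and vanish at the \<open>n\<close> roots
  of unity, so a nonzero difference would have degree below \<open>n\<close> but \<open>n\<close>
  roots.\<close>

lemma prod_roots_unity:
  assumes "n > 0"
  shows "(\<Prod>z | z ^ n = 1. [:- z, 1 :: complex:]) = monom 1 n - 1"
proof (rule ccontr)
  let ?A = "{z :: complex. z ^ n = 1}"
  let ?p = "\<Prod>z\<in>?A. [:- z, 1:]" and ?q = "monom 1 n - 1 :: complex poly"
  assume "?p \<noteq> ?q"
  hence nz: "?p - ?q \<noteq> 0" by simp
  have card: "card ?A = n"
    using assms by (intro card_roots_unity_eq) auto
  have fin: "finite ?A" using assms by (rule finite_roots_unity_pos)
  have "?A \<subseteq> {z. poly (?p - ?q) z = 0}"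
    using fin by (auto simp: poly_prod poly_monom)
  hence "n \<le> card {z. poly (?p - ?q) z = 0}"
    using card card_mono[OF poly_roots_finite[OF nz]] by metis
  also have "\<dots> \<le> degree (?p - ?q)"
    using nz by (rule card_poly_roots_bound)
  finally have "n \<le> degree (?p - ?q)" .
  moreover have "degree (?p - ?q) \<le> n"
    by (intro degree_diff_le) (auto simp: degree_prod_linear card degree_monom_eq)
  ultimately have "degree (?p - ?q) = n" by simp
  moreover have "coeff (?p - ?q) n = 0"
    using lead_coeff_prod_linear[of ?A] assms by (simp add: degree_prod_linear card)
  ultimately have "?p - ?q = 0" by (metis leading_coeff_0_iff)
  with nz show False by contradiction
qed

lemma prod_roots_unity_homogeneous:
  fixes x y :: complex
  assumes "n > 0"
  shows "(\<Prod>z | z ^ n = 1. x - z * y) = x ^ n - y ^ n"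
proof (cases "y = 0")
  case True
  thus ?thesis using card_roots_unity_eq[OF assms] assms by simp
next
  case False
  have "(\<Prod>z | z ^ n = 1. x - z * y) = (\<Prod>z | z ^ n = 1. y * (x / y - z))"
    using False by (intro prod.cong) (auto simp: field_simps)
  also have "\<dots> = y ^ n * poly (\<Prod>z | z ^ n = 1. [:- z, 1:]) (x / y)"
    using card_roots_unity_eq[OF assms] by (simp add: prod.distrib poly_prod)
  also have "\<dots> = x ^ n - y ^ n"
    using assms False by (simp add: prod_roots_unity poly_monom field_simps)
  finally show ?thesis .
qed

text \<open>By induction the product \<open>g\<close> of the cyclotomic polynomials for the proper
  divisors of \<open>e\<close> is integral and monic. Dividing X^e - 1 by \<open>g\<close> over the
  integers gives a quotient that must agree with the complex one.\<close>

lemma cyclotomic_integral: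
  assumes "e > 0"
  shows "\<exists>c :: int poly. (\<Prod>z\<in>primitive_roots_unity e. [:- z, 1:]) = map_poly of_int c"
  using assms
proof (induction e rule: less_induct)
  case (less e)
  let ?C = "\<lambda>e. \<Prod>z\<in>primitive_roots_unity e. [:- z, 1:]"
  have pos: "d > 0" if "d dvd e" for d using that less.prems by (auto intro: Nat.gr0I)
  have "\<forall>d\<in>{d. d dvd e} - {e}. \<exists>c :: int poly. ?C d = map_poly of_int c"
  proof
    fix d assume "d \<in> {d. d dvd e} - {e}"
    hence "d < e" "d > 0" using less.prems pos by (auto dest!: dvd_imp_le)
    thus "\<exists>c :: int poly. ?C d = map_poly of_int c" by (rule less.IH)
  qed
  from bchoice[OF this] obtain c :: "nat \<Rightarrow> int poly"
    where c: "\<forall>d\<in>{d. d dvd e} - {e}. ?C d = map_poly of_int (c d)" by blast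
  define g where "g = (\<Prod>d\<in>{d. d dvd e} - {e}. c d)"
  interpret mp: map_poly_inj_idom_hom "of_int :: int \<Rightarrow> complex" ..
  have g: "map_poly of_int g = (\<Prod>d\<in>{d. d dvd e} - {e}. ?C d)"
    unfolding g_def using c by (simp add: hom_distribs)
  have "lead_coeff (map_poly of_int g :: complex poly) = 1"
    unfolding g lead_coeff_prod by (simp add: lead_coeff_prod_linear del: mult_pCons_left)
  hence lc: "lead_coeff g = 1" by simp
  obtain q r where qr: "pseudo_divmod (monom 1 e - 1) g = (q, r)" by fastforce
  have g0: "g \<noteq> 0" using lc by auto
  have eq: "monom 1 e - 1 = g * q + r" and deg: "r = 0 \<or> degree r < degree g"
    using pseudo_divmod[OF g0 qr] lc by simp_all
  have "?C e * map_poly of_int g = (\<Prod>z | z ^ e = 1. [:- z, 1:])"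
    unfolding g prod_roots_unity_by_order[OF less.prems]
    using less.prems by (subst prod.remove[of "{d. d dvd e}" e]) auto
  also have "\<dots> = map_poly of_int (monom 1 e - 1)"
    using less.prems by (simp add: prod_roots_unity hom_distribs)
  also have "\<dots> = map_poly of_int g * map_poly of_int q + map_poly of_int r"
    unfolding eq by (simp add: hom_distribs)
  finally have *: "map_poly of_int g * (?C e - map_poly of_int q) = map_poly of_int r"
    by (simp add: algebra_simps)
  \<comment> \<open>A nonzero multiple of \<open>g\<close> has at least the degree of
    \<open>g\<close>, whereas \<open>r\<close> is zero or of smaller degree.\<close>
  have "?C e - map_poly of_int q = 0"
  proof (rule ccontr)
    assume nz: "?C e - map_poly of_int q \<noteq> 0"
    have r0: "r \<noteq> 0" using * nz g0 by auto
    have "degree (map_poly of_int g :: complex poly) \<le> degree (map_poly of_int r :: complex poly)"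
      unfolding *[symmetric] using nz g0 by (subst degree_mult_eq) auto
    thus False using deg r0 by simp
  qed
  thus ?case by auto
qed

text \<open>Carries integrality of a cyclotomic polynomial over to its homogeneous form:
  \<open>y ^ card A\<close> times the value at \<open>x / y\<close>, or the leading term alone if
  \<open>y = 0\<close>.\<close>

lemma prod_linear_homogenize:
  fixes x y :: "'a :: field"
  shows "(\<Prod>z\<in>A. x - z * y) =
           (\<Sum>i\<le>card A. coeff (\<Prod>z\<in>A. [:- z, 1:]) i * x ^ i * y ^ (card A - i))"
    (is "_ = (\<Sum>i\<le>_. coeff ?p i * _ * _)")
proof (cases "y = 0")
  case True
  have "(\<Sum>i\<le>card A. coeff ?p i * x ^ i * y ^ (card A - i)) =
        (\<Sum>i\<in>{card A}. coeff ?p i * x ^ i * y ^ (card A - i))"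
    using True by (intro sum.mono_neutral_right) auto
  thus ?thesis using True lead_coeff_prod_linear[of A] by (simp add: degree_prod_linear)
next
  case False
  have "(\<Prod>z\<in>A. x - z * y) = (\<Prod>z\<in>A. y * (x / y - z))"
    using False by (intro prod.cong) (auto simp: field_simps)
  also have "\<dots> = y ^ card A * poly ?p (x / y)"
    by (simp add: prod.distrib poly_prod)
  also have "\<dots> = (\<Sum>i\<le>card A. y ^ card A * (coeff ?p i * (x / y) ^ i))"
    by (simp add: poly_altdef degree_prod_linear sum_distrib_left)
  also have "\<dots> = (\<Sum>i\<le>card A. coeff ?p i * x ^ i * y ^ (card A - i))"
    using False by (intro sum.cong) (auto simp: power_diff field_simps)
  finally show ?thesis .
qed

section \<open>Moebius function and Moebius transforms\<close>

lemma moebius_mu_prime_mult: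
  assumes "prime p" "d > 0" "\<not> p dvd d"
  shows "moebius_mu (p * d) = - moebius_mu d"
proof -
  have cop: "coprime p d" using assms by (simp add: prime_imp_coprime)
  have "squarefree (p * d) \<longleftrightarrow> squarefree d"
    using squarefree_mult_coprime[OF cop] assms squarefree_prime
    by (auto dest: squarefree_multD)
  moreover have "prime_factors (p * d) = insert p (prime_factors d)"
    using assms by (subst prime_factors_product) (auto simp: prime_factorization_prime)
  moreover have "p \<notin> prime_factors d" using assms by auto
  ultimately show ?thesis by (simp add: moebius_mu_def)
qed

text \<open>For a prime \<open>p\<close> dividing \<open>k\<close>, the squarefree divisors
  \<open>d\<close> not divisible by \<open>p\<close> cancel against their multiples
  \<open>p * d\<close>.\<close>

lemma sum_moebius_mu:
  assumes "k > 1"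
  shows "(\<Sum>d | d dvd k. moebius_mu d) = 0"
proof -
  from assms obtain p where p: "prime p" "p dvd k"
    using prime_factor_nat[of k] by auto
  let ?A = "{d. d dvd k \<and> squarefree d \<and> \<not> p dvd d}"
  have fin: "finite {d. d dvd k}" using assms by simp
  have inj: "inj_on ((*) p) ?A" using p by (auto simp: inj_on_def)
  have "(\<Sum>d | d dvd k. moebius_mu d) = (\<Sum>d | d dvd k \<and> squarefree d. moebius_mu d)"
    using fin by (intro sum.mono_neutral_right) (auto simp: moebius_mu_def)
  also have "{d. d dvd k \<and> squarefree d} = ?A \<union> (*) p ` ?A"
  proof (intro equalityI subsetI)
    fix d assume d: "d \<in> {d. d dvd k \<and> squarefree d}"
    show "d \<in> ?A \<union> (*) p ` ?A"
    proof (cases "p dvd d")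
      case True
      then obtain c where c: "d = p * c" by (elim dvdE)
      have "\<not> p dvd c"
      proof
        assume "p dvd c"
        hence "p ^ 2 dvd d" by (auto simp: c power2_eq_square)
        with d p show False by (auto simp: squarefree_def)
      qed
      moreover have "squarefree c" "c dvd k"
        using d c by (auto dest: squarefree_multD dvd_mult_right)
      ultimately show ?thesis using c by blast
    qed (use d in auto)
  next
    fix d assume "d \<in> ?A \<union> (*) p ` ?A"
    moreover have "p * c dvd k \<and> squarefree (p * c)" if c: "c \<in> ?A" for c
    proof -
      have cop: "coprime p c" using c p by (simp add: prime_imp_coprime)
      thus ?thesis
        using c p by (auto intro: divides_mult squarefree_mult_coprime squarefree_prime)
    qed
    ultimately show "d \<in> {d. d dvd k \<and> squarefree d}" by auto
  qed
  also have "(\<Sum>d\<in>?A \<union> (*) p ` ?A. moebius_mu d) =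
               (\<Sum>d\<in>?A. moebius_mu d) + (\<Sum>d\<in>(*) p ` ?A. moebius_mu d)"
    using fin by (intro sum.union_disjoint) auto
  also have "(\<Sum>d\<in>(*) p ` ?A. moebius_mu d) = (\<Sum>d\<in>?A. moebius_mu (p * d))"
    using inj by (simp add: sum.reindex)
  also have "\<dots> = (\<Sum>d\<in>?A. - moebius_mu d)"
    using p assms by (intro sum.cong refl moebius_mu_prime_mult) (auto intro: Nat.gr0I)
  finally show ?thesis by (simp add: sum_negf)
qed

text \<open>If \<open>l\<close> divides \<open>n\<close>, substituting d = n / m gives the sum of
  \<open>moebius_mu\<close> over the divisors of n / l; otherwise the sum is empty.\<close>

lemma sum_moebius_mu_between:
  assumes "n > 0"
  shows "(\<Sum>m | l dvd m \<and> m dvd n. moebius_mu (n div m)) = (if l = n then 1 else 0)"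
proof (cases "l dvd n")
  case False
  hence empty: "{m. l dvd m \<and> m dvd n} = {}" by (auto dest: dvd_trans)
  show ?thesis unfolding empty using False by auto
next
  case True
  then obtain k where n: "n = l * k" by (elim dvdE)
  have pos: "l > 0" "k > 0" using n assms by auto
  have "(\<Sum>m | l dvd m \<and> m dvd n. moebius_mu (n div m)) = (\<Sum>d | d dvd k. moebius_mu d)"
  proof (rule sum.reindex_bij_witness[of _ "\<lambda>d. n div d" "\<lambda>m. n div m"])
    fix m assume "m \<in> {m. l dvd m \<and> m dvd n}"
    then obtain a b where "m = l * a" "n = m * b" by (auto elim!: dvdE)
    thus "n div (n div m) = m" "n div m \<in> {d. d dvd k}"
      using assms pos n by auto
  next
    fix d assume "d \<in> {d. d dvd k}"
    then obtain a where "k = d * a" by (auto elim!: dvdE)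
    thus "n div (n div d) = d" "n div d \<in> {m. l dvd m \<and> m dvd n}"
      using assms pos n by auto
  qed simp
  also have "\<dots> = (if l = n then 1 else 0)"
  proof (cases "k = 1")
    case True
    thus ?thesis using n by (simp add: moebius_mu_def)
  next
    case False
    thus ?thesis using n pos sum_moebius_mu[of k] by auto
  qed
  finally show ?thesis .
qed

text \<open>Expanding the products, the Moebius sum keeps exactly the sets of divisors whose least
  common multiple is \<open>n\<close>.\<close>
lemma moebius_transform_divisor_prod_nonneg:
  fixes F :: "nat \<Rightarrow> real"
  assumes n: "n > 0" and F: "\<And>e. e dvd n \<Longrightarrow> F e \<ge> 1"
  shows "(\<Sum>m | m dvd n. of_int (moebius_mu (n div m)) * (\<Prod>e | e dvd m. F e)) \<ge> 0"
proof -
  define g where "g S = (\<Prod>e\<in>S. F e - 1)" for S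
  define D where "D = {m. m dvd n}"
  have fin: "finite D" using n by (simp add: D_def)
  have expand: "(\<Prod>e | e dvd m. F e) = (\<Sum>S\<in>Pow D. if Lcm S dvd m then g S else 0)"
    if m: "m \<in> D" for m
  proof -
    have m0: "m > 0" using m n by (auto simp: D_def intro: Nat.gr0I)
    have sub: "{e. e dvd m} \<subseteq> D" using m by (auto simp: D_def intro: dvd_trans)
    have "(\<Prod>e | e dvd m. F e) = (\<Prod>e | e dvd m. (F e - 1) + 1)" by simp
    also have "\<dots> = (\<Sum>S\<in>Pow {e. e dvd m}. g S)"
      using m0 by (subst prod_add) (auto simp: g_def)
    \<comment> \<open>A set \<open>S\<close> of divisors of \<open>n\<close> consists of divisors of
      \<open>m\<close> exactly if \<open>Lcm S dvd m\<close>. The index set \<open>Pow D\<close> no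
      longer depends on \<open>m\<close>, so the sums can be swapped.\<close>
    also have "\<dots> = (\<Sum>S\<in>Pow D. if Lcm S dvd m then g S else 0)"
      using sub fin by (intro sum.mono_neutral_cong_left) (auto simp: Lcm_dvd_iff)
    finally show ?thesis .
  qed
  have "(\<Sum>m\<in>D. of_int (moebius_mu (n div m)) * (\<Prod>e | e dvd m. F e)) =
        (\<Sum>m\<in>D. \<Sum>S\<in>Pow D. if Lcm S dvd m then of_int (moebius_mu (n div m)) * g S else 0)"
    by (intro sum.cong refl) (simp add: expand sum_distrib_left if_distrib cong: if_cong)
  also have "\<dots> = (\<Sum>S\<in>Pow D. \<Sum>m\<in>D. if Lcm S dvd m then of_int (moebius_mu (n div m)) * g S else 0)"
    by (rule sum.swap)
  also have "\<dots> = (\<Sum>S\<in>Pow D. if Lcm S = n then g S else 0)"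
  proof (intro sum.cong refl)
    fix S
    have "(\<Sum>m\<in>D. if Lcm S dvd m then of_int (moebius_mu (n div m)) * g S else 0) =
          (\<Sum>m | Lcm S dvd m \<and> m dvd n. of_int (moebius_mu (n div m)) * g S)"
      using fin by (intro sum.mono_neutral_cong_right) (auto simp: D_def)
    also have "\<dots> = of_int (\<Sum>m | Lcm S dvd m \<and> m dvd n. moebius_mu (n div m)) * g S"
      by (simp add: sum_distrib_right)
    also have "\<dots> = (if Lcm S = n then g S else 0)"
      using sum_moebius_mu_between[OF n, of "Lcm S"] by simp
    finally show "(\<Sum>m\<in>D. if Lcm S dvd m then of_int (moebius_mu (n div m)) * g S else 0) =
                  (if Lcm S = n then g S else 0)" .
  qed
  also have "\<dots> \<ge> 0"
    using F by (intro sum_nonneg) (auto simp: g_def D_def intro!: prod_nonneg)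
  finally show ?thesis by (simp add: D_def)
qed

section \<open>Products over pairs of list entries\<close>

fun pair_prod :: "('a \<Rightarrow> 'a \<Rightarrow> 'b :: comm_monoid_mult) \<Rightarrow> 'a list \<Rightarrow> 'b" where
  "pair_prod g [] = 1"
| "pair_prod g (x # xs) = (\<Prod>y\<leftarrow>xs. g x y) * pair_prod g xs"

lemma pair_prod_mult: "pair_prod (\<lambda>x y. g x y * h x y) xs = pair_prod g xs * pair_prod h xs"
proof (induction xs)
  case (Cons x xs)
  have "(\<Prod>y\<leftarrow>xs. g x y * h x y) = (\<Prod>y\<leftarrow>xs. g x y) * (\<Prod>y\<leftarrow>xs. h x y)"
    by (induction xs) (simp_all add: mult_ac)
  with Cons show ?case by (simp add: mult_ac)
qed simp

lemma pair_prod_map: "pair_prod g (map f xs) = pair_prod (\<lambda>x y. g (f x) (f y)) xs"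
  by (induction xs) (simp_all add: o_def)

text \<open>By symmetry any entry can be moved to the front, which matches the heads of two lists
  with equal multisets.\<close>

lemma pair_prod_cong_mset:
  assumes sym: "\<And>x y. g x y = g y x"
  shows "mset xs = mset ys \<Longrightarrow> pair_prod g xs = pair_prod g ys"
proof (induction xs arbitrary: ys)
  case (Cons x xs)
  have move: "pair_prod g (us @ x # vs) = pair_prod g (x # us @ vs)" for us vs
    by (induction us) (simp_all add: sym[of _ x] mult_ac)
  from Cons.prems have "x \<in> set ys"
    using mset_eq_setD[OF Cons.prems] by auto
  then obtain us vs where ys: "ys = us @ x # vs"
    by (meson split_list)
  from Cons.prems ys have m: "mset xs = mset (us @ vs)"
    by simp
  have "(\<Prod>y\<leftarrow>xs. g x y) = (\<Prod>y\<leftarrow>us @ vs. g x y)"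
    unfolding prod_mset_prod_list[symmetric] mset_map m by simp
  with Cons.IH[OF m] show ?case
    unfolding ys move by simp
qed simp

text \<open>The two orders of each pair of positions yield every ordered pair of distinct elements
  once. This leads from the pairs j < k of a discriminant to the ordered pairs of a norm.\<close>

lemma pair_prod_symmetrize:
  assumes "distinct xs"
  shows "pair_prod (\<lambda>x y. g x y * g y x) xs = (\<Prod>x\<in>set xs. \<Prod>y\<in>set xs - {x}. g x y)"
  using assms
proof (induction xs)
  case (Cons a xs)
  let ?A = "set xs"
  have a: "a \<notin> ?A" "distinct xs" using Cons.prems by auto
  have "(\<Prod>x\<in>?A. \<Prod>y\<in>insert a ?A - {x}. g x y) = (\<Prod>x\<in>?A. g x a * (\<Prod>y\<in>?A - {x}. g x y))"
  proof (intro prod.cong refl)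
    fix x assume "x \<in> ?A"
    hence "insert a ?A - {x} = insert a (?A - {x})" using a by auto
    thus "(\<Prod>y\<in>insert a ?A - {x}. g x y) = g x a * (\<Prod>y\<in>?A - {x}. g x y)"
      using a by simp
  qed
  moreover have "(\<Prod>y\<leftarrow>xs. g a y * g y a) = (\<Prod>y\<in>?A. g a y) * (\<Prod>y\<in>?A. g y a)"
    using a by (simp flip: prod.distinct_set_conv_list add: prod.distrib)
  ultimately show ?case
    using a Cons.IH by (simp add: prod.distrib mult_ac)
qed simp

lemma prod_sq_diffs_eq_pair_prod: "prod_sq_diffs xs = pair_prod (\<lambda>x y. (x - y)\<^sup>2) xs"
  by (induction xs) simp_all

lemma distinct_if_prod_sq_diffs_nonzero: "prod_sq_diffs xs \<noteq> 0 \<Longrightarrow> distinct xs"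
  by (induction xs) (auto simp: prod_list_zero_iff)

text \<open>With d = \<open>length xs\<close> this is the sign (-1)^(d(d-1)/2) between a
  discriminant and the product over ordered pairs.\<close>

lemma pair_prod_minus_1: "pair_prod (\<lambda>_ _. -1) xs \<in> {1, -1 :: complex}"
proof (induction xs)
  case (Cons x xs)
  have "(\<Prod>y\<leftarrow>xs. -1) \<in> {1, -1 :: complex}"
    by (induction xs) auto
  with Cons show ?case by auto
qed simp

section \<open>Cyclotomic norms\<close>

lemma cyclotomic_pair_int_eval2:
  assumes "e > 0"
  shows "\<exists>f. \<forall>x y. (\<Prod>z\<in>primitive_roots_unity e. y - z * x) = int_eval2 x y f"
proof -
  let ?Z = "primitive_roots_unity e"
  obtain c :: "int poly" where c: "(\<Prod>z\<in>?Z. [:- z, 1:]) = map_poly of_int c"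
    using cyclotomic_integral[OF assms] by blast
  \<comment> \<open>The outer exponent \<open>i\<close> belongs to \<open>y\<close>, the
    complementary inner exponent to \<open>x\<close>.\<close>
  define f where "f = (\<Sum>i\<le>card ?Z. monom (monom (coeff c i) (card ?Z - i)) i)"
  have "(\<Prod>z\<in>?Z. y - z * x) = int_eval2 x y f" for x y
  proof -
    interpret comm_ring_hom "int_eval2 x y" by (rule comm_ring_hom_int_eval2)
    show ?thesis
      unfolding prod_linear_homogenize c f_def
      by (simp add: hom_sum int_eval2_monom int_eval_monom coeff_map_poly mult_ac)
  qed
  thus ?thesis by blast
qed

text \<open>For \<open>A\<close> the set of roots this is \<open>N\<^sub>e\<close>; for
  \<open>e = 1\<close> it is the discriminant up to sign.\<close>

definition cyclotomic_norm :: "complex set \<Rightarrow> nat \<Rightarrow> complex" where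
  "cyclotomic_norm A e = (\<Prod>x\<in>A. \<Prod>y\<in>A - {x}. \<Prod>z\<in>primitive_roots_unity e. y - z * x)"

lemma cyclotomic_norm_in_Ints:
  fixes P :: "int poly"
  assumes "lead_coeff P = 1" "A = {x. int_eval x P = 0}" "card A = degree P" "e > 0"
  shows "cyclotomic_norm A e \<in> \<int>"
proof -
  obtain f where "\<And>x y. (\<Prod>z\<in>primitive_roots_unity e. y - z * x) = int_eval2 x y f"
    using cyclotomic_pair_int_eval2[OF assms(4)] by blast
  thus ?thesis
    using prod_distinct_root_pairs_in_Ints[OF assms(1-3)] by (simp add: cyclotomic_norm_def)
qed

text \<open>The factors \<open>y - z * x\<close> of \<open>y ^ n - x ^ n\<close> are grouped by the
  order of \<open>z\<close>.\<close>

lemma prod_cyclotomic_norm: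
  assumes "n > 0"
  shows "(\<Prod>e | e dvd n. cyclotomic_norm A e) = (\<Prod>x\<in>A. \<Prod>y\<in>A - {x}. y ^ n - x ^ n)"
proof -
  have "(\<Prod>x\<in>A. \<Prod>y\<in>A - {x}. y ^ n - x ^ n) =
        (\<Prod>x\<in>A. \<Prod>y\<in>A - {x}. \<Prod>e | e dvd n. \<Prod>z\<in>primitive_roots_unity e. y - z * x)"
    using assms
    by (simp add: prod_roots_unity_homogeneous[symmetric] prod_roots_unity_by_order)
  also have "\<dots> = (\<Prod>e | e dvd n. cyclotomic_norm A e)"
    unfolding cyclotomic_norm_def prod.swap[of _ _ "{e. e dvd n}"] ..
  finally show ?thesis ..
qed

lemma prod_sq_diffs_power_eq:
  assumes "distinct xs" "n > 0"
  shows "prod_sq_diffs (map (\<lambda>x. x ^ n) xs) =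
           pair_prod (\<lambda>_ _. -1) xs * (\<Prod>e | e dvd n. cyclotomic_norm (set xs) e)"
proof -
  \<comment> \<open>Writing a square as a product of the two ordered differences costs one factor -1
    per pair.\<close>
  have "(\<lambda>x y :: complex. (x ^ n - y ^ n)\<^sup>2) =
        (\<lambda>x y. (-1) * ((y ^ n - x ^ n) * (x ^ n - y ^ n)))"
    by (auto simp: fun_eq_iff power2_eq_square algebra_simps)
  hence "prod_sq_diffs (map (\<lambda>x. x ^ n) xs) =
         pair_prod (\<lambda>x y. (-1) * ((y ^ n - x ^ n) * (x ^ n - y ^ n))) xs"
    by (simp add: prod_sq_diffs_eq_pair_prod pair_prod_map)
  also have "\<dots> = pair_prod (\<lambda>_ _. -1) xs *
                  pair_prod (\<lambda>x y. (y ^ n - x ^ n) * (x ^ n - y ^ n)) xs"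
    by (rule pair_prod_mult)
  also have "pair_prod (\<lambda>x y. (y ^ n - x ^ n) * (x ^ n - y ^ n)) xs =
               (\<Prod>e | e dvd n. cyclotomic_norm (set xs) e)"
    using pair_prod_symmetrize[OF assms(1), of "\<lambda>x y. y ^ n - x ^ n"] prod_cyclotomic_norm[OF assms(2)]
    by simp
  finally show ?thesis .
qed

section \<open>Conjugation and the sign of the discriminants\<close>

lemma cnj_pair_prod: "cnj (pair_prod g xs) = pair_prod (\<lambda>x y. cnj (g x y)) xs"
proof (induction xs)
  case (Cons x xs)
  have "cnj (\<Prod>y\<leftarrow>xs. g x y) = (\<Prod>y\<leftarrow>xs. cnj (g x y))" by (induction xs) auto
  with Cons show ?case by simp
qed simp

text \<open>The quotient is the square of the symmetric function
  \<open>\<Prod>\<^bsub>j < k\<^esub> (\<alpha>\<^sub>j\<^sup>n - \<alpha>\<^sub>k\<^sup>n) / (\<alpha>\<^sub>j - \<alpha>\<^sub>k)\<close>, which complex conjugation fixes.\<close>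
lemma prod_sq_diffs_power_eq_mult_square:
  assumes "mset (map cnj xs) = mset xs"
  obtains w :: real where
    "prod_sq_diffs (map (\<lambda>x. x ^ n) xs) = prod_sq_diffs xs * (of_real w)\<^sup>2"
proof -
  \<comment> \<open>The quotient (x^n - y^n) / (x - y) as a polynomial, defined also for coinciding
    entries.\<close>
  define g where "g x y = (\<Sum>i<n. y ^ (n - Suc i) * x ^ i)" for x y :: complex
  have sym: "g x y = g y x" for x y
    unfolding g_def
    by (subst sum.nat_diff_reindex[symmetric]) (auto intro!: sum.cong)
  have "cnj (pair_prod g xs) = pair_prod g (map cnj xs)"
    by (simp add: cnj_pair_prod pair_prod_map g_def)
  also have "\<dots> = pair_prod g xs"
    using sym assms by (rule pair_prod_cong_mset)
  finally have "pair_prod g xs \<in> \<real>" by (simp add: Reals_cnj_iff)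
  then obtain w where w: "pair_prod g xs = of_real w" by (elim Reals_cases)
  have "(\<lambda>x y :: complex. (x ^ n - y ^ n)\<^sup>2) = (\<lambda>x y. (x - y)\<^sup>2 * (g x y * g x y))"
    by (auto simp: fun_eq_iff g_def power_diff_sumr2 power2_eq_square)
  hence "prod_sq_diffs (map (\<lambda>x. x ^ n) xs) =
         pair_prod (\<lambda>x y. (x - y)\<^sup>2 * (g x y * g x y)) xs"
    by (simp add: prod_sq_diffs_eq_pair_prod pair_prod_map)
  also have "\<dots> = prod_sq_diffs xs * (of_real w)\<^sup>2"
    by (simp only: pair_prod_mult w prod_sq_diffs_eq_pair_prod power2_eq_square)
  finally show ?thesis by (rule that)
qed

section \<open>Moebius sums of the discriminants\<close>

theorem theorem8p9:
  fixes P :: "int poly"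
  assumes "lead_coeff P = 1"
    and "\<And>n::nat. n \<ge> 1 \<Longrightarrow> discriminant (power_poly P n) \<noteq> 0"
  shows "(\<forall>n\<ge>1. delta P n \<in> \<int>) \<and>
         ((\<forall>n\<ge>1. Re (delta P n) \<ge> 0) \<or> (\<forall>n\<ge>1. Re (delta P n) \<le> 0))"
proof -
  let ?P = "map_poly of_int P :: complex poly"
  obtain xs where xs: "mset xs = proots ?P" using ex_mset by blast
  have disc: "discriminant (power_poly P n) = prod_sq_diffs (map (\<lambda>x. x ^ n) xs)" for n
    using xs by (intro discriminant_eq) (simp add: proots_power_poly)
  have P0: "?P \<noteq> 0" using assms(1) by auto
  \<comment> \<open>The case n = 1 concerns \<open>P\<close> itself and makes its roots
    simple.\<close>
  have "prod_sq_diffs xs \<noteq> 0" using assms(2)[of 1] by (simp add: disc)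
  hence dist: "distinct xs" by (rule distinct_if_prod_sq_diffs_nonzero)
  have set_xs: "set xs = {x. int_eval x P = 0}"
    using P0 by (simp add: set_mset_mset[symmetric] xs int_eval_def del: set_mset_mset)
  have "length xs = degree P"
    using size_proots_complex[of ?P] by (simp flip: xs)
  hence card_xs: "card (set xs) = degree P" by (simp add: distinct_card dist)
  \<comment> \<open>Conjugation preserves the roots because \<open>P\<close> has real coefficients;
    as they are simple, it permutes the list.\<close>
  have "cnj x \<in> set xs" if "x \<in> set xs" for x
    using that real_poly_cnj_root_iff[of ?P x] by (simp add: set_xs int_eval_def coeff_map_poly)
  hence "set (map cnj xs) = set xs" by (auto intro: image_eqI[of _ _ "cnj _"])
  moreover have "distinct (map cnj xs)" using dist by (simp add: distinct_map inj_on_def)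
  ultimately have cnj_xs: "mset (map cnj xs) = mset xs"
    using dist set_eq_iff_mset_eq_distinct by blast

  let ?D = "\<lambda>n. prod_sq_diffs (map (\<lambda>x. x ^ n) xs)"
  let ?N = "cyclotomic_norm (set xs)"
  have D_eq: "?D n = pair_prod (\<lambda>_ _. -1) xs * (\<Prod>e | e dvd n. ?N e)" if "n > 0" for n
    using prod_sq_diffs_power_eq[OF dist that] .
  have N_int: "?N e \<in> \<int>" if "e > 0" for e
    using cyclotomic_norm_in_Ints[OF assms(1) set_xs card_xs that] .
  have D_nz: "?D n \<noteq> 0" if "n > 0" for n
    using assms(2)[of n] that by (simp add: disc)
  \<comment> \<open>\<open>?N e\<close> is a factor of \<open>?D e\<close>, hence nonzero, and a
    nonzero integer has absolute value at least 1.\<close>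
  have N_ge: "norm (?N e) \<ge> 1" if e: "e > 0" for e
  proof -
    have "?N e \<noteq> 0"
      using D_nz[OF e] D_eq[OF e] e by (auto simp: prod_zero_iff)
    moreover obtain k where "?N e = of_int k" using N_int[OF e] by (elim Ints_cases)
    ultimately show ?thesis by (simp add: norm_of_int)
  qed
  have norm_D: "norm (?D n) = (\<Prod>e | e dvd n. norm (?N e))" if "n > 0" for n
    using pair_prod_minus_1[of xs] by (auto simp: D_eq[OF that] norm_mult prod_norm)
  have D_int: "?D n \<in> \<int>" if "n > 0" for n
    unfolding D_eq[OF that] using pair_prod_minus_1[of xs] N_int that
    by (intro Ints_mult Ints_prod) (auto intro: Nat.gr0I)

  define s where "s = sgn (Re (prod_sq_diffs xs))"
  \<comment> \<open>\<open>?D n\<close> is the integer \<open>prod_sq_diffs xs\<close> times a real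
    square, so its sign is \<open>s\<close> for every \<open>n\<close>.\<close>
  have D_sgn: "?D n = of_real (s * norm (?D n))" if n: "n > 0" for n
  proof -
    have "prod_sq_diffs xs \<in> \<int>" using D_int[of 1] by simp
    then obtain k where k: "prod_sq_diffs xs = of_int k" by (elim Ints_cases)
    obtain w where "?D n = prod_sq_diffs xs * (of_real w)\<^sup>2"
      using prod_sq_diffs_power_eq_mult_square[OF cnj_xs] .
    hence "?D n = of_real (of_int k * w\<^sup>2)" by (simp add: k)
    moreover have "of_int k * w\<^sup>2 = s * \<bar>of_int k * w\<^sup>2\<bar>"
      by (simp add: s_def k abs_mult sgn_mult_abs flip: mult.assoc)
    ultimately show ?thesis by (metis norm_of_real)
  qed
  \<comment> \<open>The Moebius transform of the absolute values of the discriminants; pulling out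
    the common sign \<open>s\<close> gives \<open>delta P n\<close>.\<close>
  define T where "T n = (\<Sum>m | m dvd n. of_int (moebius_mu (n div m)) * (\<Prod>e | e dvd m. norm (?N e)))" for n
  have delta_eq: "delta P n = of_real (s * T n)" if "n > 0" for n
  proof -
    have "delta P n = (\<Sum>m | m dvd n. of_int (moebius_mu (n div m)) * of_real (s * norm (?D m)))"
      unfolding delta_def disc
      using that by (intro sum.cong arg_cong2[where f = "(*)"] refl D_sgn) (auto intro: Nat.gr0I)
    also have "\<dots> = of_real (s * (\<Sum>m | m dvd n. of_int (moebius_mu (n div m)) * norm (?D m)))"
      by (simp add: sum_distrib_left mult_ac)
    also have "(\<Sum>m | m dvd n. of_int (moebius_mu (n div m)) * norm (?D m)) = T n"
      unfolding T_def
      using that by (intro sum.cong arg_cong2[where f = "(*)"] refl norm_D) (auto intro: Nat.gr0I)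
    finally show ?thesis .
  qed
  have T_nonneg: "T n \<ge> 0" if "n > 0" for n
    unfolding T_def using that
    by (intro moebius_transform_divisor_prod_nonneg N_ge) (auto intro: Nat.gr0I)
  have "delta P n \<in> \<int>" if "n > 0" for n
    unfolding delta_def disc using that
    by (intro Ints_sum Ints_mult Ints_of_int D_int) (auto intro: Nat.gr0I)
  moreover have "(\<forall>n\<ge>1. Re (delta P n) \<ge> 0) \<or> (\<forall>n\<ge>1. Re (delta P n) \<le> 0)"
  proof (cases "s \<ge> 0")
    case True
    thus ?thesis using T_nonneg by (simp add: delta_eq)
  next
    case False
    thus ?thesis using T_nonneg by (simp add: delta_eq mult_nonpos_nonneg)
  qed
  ultimately show ?thesis by simp
qed

end
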